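(* Let $a_1,a_2,b_1,b_2,\dots,f_1,f_2$ be twelve independent variables over $\mathbf{Q}$, and consider the six general linear forms $a_{\mathbf{x}}=a_1x_1+a_2x_2$, $b_{\mathbf{x}}=b_1x_1+b_2x_2$, $c_{\mathbf{x}}=c_1x_1+c_2x_2$, $d_{\mathbf{x}}=d_1x_1+d_2x_2$, $e_{\mathbf{x}}=e_1x_1+e_2x_2$, $f_{\mathbf{x}}=f_1x_1+f_2x_2$ in the variables $x_1,x_2$. Put $$U=(b_{\mathbf{x}}c_{\mathbf{x}},\,d_{\mathbf{x}}f_{\mathbf{x}})_1,\quad V=(a_{\mathbf{x}}c_{\mathbf{x}},\,d_{\mathbf{x}}e_{\mathbf{x}})_1,\quad W=(a_{\mathbf{x}}b_{\mathbf{x}},\,e_{\mathbf{x}}f_{\mathbf{x}})_1,$$ $$\psi(U,V,W)=6\,(U,VW)_2-U\,(V,W)_2,$$ $$\mathcal{S}=(da)(fc)(eb)-(ce)(bd)(af).$$ Then $$\psi(U,V,W)=\Phi\; a_{\mathbf{x}}\,e_{\mathbf{x}},\qquad\text{where}\quad \Phi=\tfrac34\,(cd)(bf)\,\mathcal{S}.$$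
   Context: Bracket notation: $(ab)=a_1b_2-a_2b_1$, and similarly for any other pair of letters, e.g. $(cd)=c_1d_2-c_2d_1$. Transvectants: for binary forms $G,H$ in $x_1,x_2$ of degrees $m,n$ and an integer $r\ge 0$, the $r$-th transvectant is $$(G,H)_r=\frac{(m-r)!\,(n-r)!}{m!\,n!}\sum_{i=0}^r(-1)^i\binom{r}{i}\frac{\partial^rG}{\partial x_1^{r-i}\partial x_2^{i}}\,\frac{\partial^rH}{\partial x_1^{i}\partial x_2^{r-i}},$$ a form of degree $m+n-2r$ (or zero). Here $U,V,W$ are quadratic forms, $VW$ is the quartic product form, and $(V,W)_2$ is a scalar. *)

theory Defs
  imports "HOL-Library.Poly_Mapping" "HOL-Computational_Algebra.Polynomial"
begin

datatype coeff_var = A1 | A2 | B1 | B2 | C1 | C2 | D1 | D2 | E1 | E2 | F1 | F2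

text \<open>
  The linear order on the indeterminates has no mathematical role: the library derives the absence
  of zero divisors in the polynomial ring, which \<^const>\<open>pderiv\<close> requires of its coefficient ring, from
  an order on the monomials.
\<close>

fun coeff_var_rank :: "coeff_var \<Rightarrow> nat" where
  "coeff_var_rank A1 = 0" | "coeff_var_rank A2 = 1"
| "coeff_var_rank B1 = 2" | "coeff_var_rank B2 = 3"
| "coeff_var_rank C1 = 4" | "coeff_var_rank C2 = 5"
| "coeff_var_rank D1 = 6" | "coeff_var_rank D2 = 7"
| "coeff_var_rank E1 = 8" | "coeff_var_rank E2 = 9"
| "coeff_var_rank F1 = 10" | "coeff_var_rank F2 = 11"

lemma coeff_var_rank_inject: "coeff_var_rank v = coeff_var_rank w \<Longrightarrow> v = w"
  by (cases v; cases w) simp_all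

instantiation coeff_var :: linorder
begin

definition less_eq_coeff_var :: "coeff_var \<Rightarrow> coeff_var \<Rightarrow> bool" where
  "v \<le> w \<longleftrightarrow> coeff_var_rank v \<le> coeff_var_rank w"

definition less_coeff_var :: "coeff_var \<Rightarrow> coeff_var \<Rightarrow> bool" where
  "v < w \<longleftrightarrow> coeff_var_rank v < coeff_var_rank w"

instance
  by standard
    (auto simp: less_eq_coeff_var_def less_coeff_var_def intro: coeff_var_rank_inject)

end

text \<open>
  The coefficient ring is \<open>R = Q[a\<^sub>1, a\<^sub>2, ..., f\<^sub>1, f\<^sub>2]\<close>; a monomial is the finitely supported
  function giving its exponents.
\<close>

type_synonym coeff_ring = "(coeff_var \<Rightarrow>\<^sub>0 nat) \<Rightarrow>\<^sub>0 rat"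

definition indet :: "coeff_var \<Rightarrow> coeff_ring" where
  "indet v = Poly_Mapping.single (Poly_Mapping.single v 1) 1"

definition rat_const :: "rat \<Rightarrow> coeff_ring" where
  "rat_const q = Poly_Mapping.single 0 q"

text \<open>
  Forms are elements of \<open>R[x\<^sub>2][x\<^sub>1]\<close>: the outer variable is \<open>x\<^sub>1\<close> and the inner one is \<open>x\<^sub>2\<close>.
\<close>

type_synonym form = "coeff_ring poly poly"

definition x1 :: form where "x1 = [:0, 1:]"
definition x2 :: form where "x2 = [:[:0, 1:]:]"

definition scalar :: "coeff_ring \<Rightarrow> form" where
  "scalar r = [:[:r:]:]"

definition deriv_x1 :: "form \<Rightarrow> form" where
  "deriv_x1 = pderiv"

definition deriv_x2 :: "form \<Rightarrow> form" where
  "deriv_x2 = map_poly pderiv"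

definition linear_form :: "coeff_ring \<times> coeff_ring \<Rightarrow> form" where
  "linear_form p = scalar (fst p) * x1 + scalar (snd p) * x2"

definition bracket :: "coeff_ring \<times> coeff_ring \<Rightarrow> coeff_ring \<times> coeff_ring \<Rightarrow> coeff_ring" where
  "bracket p q = fst p * snd q - snd p * fst q"

text \<open>
  \<open>transvectant m n r G H\<close> is \<open>(G, H)\<^sub>r\<close> for \<open>G\<close> and \<open>H\<close> regarded as forms of degrees \<open>m\<close> and \<open>n\<close>;
  the degrees are arguments because the normalising factor depends on them and the zero form
  does not determine its own.
\<close>

definition transvectant :: "nat \<Rightarrow> nat \<Rightarrow> nat \<Rightarrow> form \<Rightarrow> form \<Rightarrow> form" where
  "transvectant m n r G H =
     scalar (rat_const (fact (m - r) * fact (n - r) / (fact m * fact n))) *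
     (\<Sum>i = 0..r. (-1) ^ i * of_nat (r choose i)
        * (deriv_x1 ^^ (r - i)) ((deriv_x2 ^^ i) G)
        * (deriv_x1 ^^ i) ((deriv_x2 ^^ (r - i)) H))"

text \<open>The arguments of \<open>\<psi>\<close> are quadratic forms, so that \<open>V * W\<close> is a quartic form.\<close>

definition psi :: "form \<Rightarrow> form \<Rightarrow> form \<Rightarrow> form" where
  "psi U V W = 6 * transvectant 2 4 2 U (V * W) - U * transvectant 2 2 2 V W"

end

theory Submission
  imports Defs
begin

text \<open>
  If \<open>U\<close>, \<open>V\<close>, \<open>W\<close> are first transvectants of quadratic forms, their outer coefficients carry a
  factor \<open>1/2\<close> and their middle coefficients none. With these halves split off, the coefficients of
  \<open>\<psi>(U, V, W)\<close> are \<open>3/4\<close> times integral trilinear expressions in those of \<open>U\<close>, \<open>V\<close>, \<open>W\<close>, and the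
  claim becomes three integral polynomial identities in the twelve coefficients of the linear forms.
\<close>

lemma rat_const_mult: "rat_const (p * q) = rat_const p * rat_const q"
  by (simp add: rat_const_def mult_single)

lemma rat_const_add: "rat_const (p + q) = rat_const p + rat_const q"
  by (simp add: rat_const_def single_add)

lemma rat_const_1: "rat_const 1 = 1"
  by (simp add: rat_const_def)

lemma rat_const_of_nat: "rat_const (of_nat n) = of_nat n"
  by (induction n) (simp_all add: rat_const_add rat_const_1, simp add: rat_const_def)

text \<open>With \<open>rat_const_mult\<close> this turns every fraction in use into an integral
  multiple of one constant, leaving only ring arithmetic.\<close>

lemma rat_const_numeral: "rat_const (numeral n) = numeral n"
  using rat_const_of_nat[of "numeral n"] by simp

text \<open>The arguments belong to x1^2, x1 x2, x2^2, without binomial factors; the list is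
  reversed because it starts with the part free of \<open>x1\<close>.\<close>

definition quadratic :: "coeff_ring \<Rightarrow> coeff_ring \<Rightarrow> coeff_ring \<Rightarrow> form" where
  "quadratic p q r = [:[:0, 0, r:], [:0, q:], [:p:]:]"

lemma linear_form_mult:
  "linear_form p * linear_form q =
     quadratic (fst p * fst q) (fst p * snd q + snd p * fst q) (snd p * snd q)"
  by (simp add: linear_form_def scalar_def x1_def x2_def quadratic_def algebra_simps)

lemma scalar_mult_quadratic: "scalar s * quadratic p q r = quadratic (s * p) (s * q) (s * r)"
  by (simp add: scalar_def quadratic_def)

text \<open>The Jacobian has 2, 4, 2 times these minors as coefficients, \<open>g1 * h1\<close>
  cancelling in the middle; the normalising factor is 1/4.\<close>

lemma transvectant_quadratic_1:
  "transvectant 2 2 1 (quadratic g0 g1 g2) (quadratic h0 h1 h2) =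
     quadratic (rat_const (1 / 2) * (g0 * h1 - g1 * h0)) (g0 * h2 - g2 * h0)
       (rat_const (1 / 2) * (g1 * h2 - g2 * h1))"
proof -
  have half: "rat_const (1 / 2) = rat_const (1 / 4) * 2"
    and one: "rat_const (1 / 4) * 4 = 1"
    using rat_const_mult[of "1/4" 2] rat_const_mult[of "1/4" 4]
    by (simp_all add: rat_const_numeral rat_const_1)
  \<comment> \<open>The middle coefficient must show a factor 1/4 too before \<open>scalar\<close>
    can be pulled out of all three.\<close>
  have "g0 * h2 - g2 * h0 = rat_const (1 / 4) * 4 * (g0 * h2 - g2 * h0)"
    by (simp only: one mult_1)
  then have mid: "g0 * h2 - g2 * h0 = rat_const (1 / 4) * (4 * (g0 * h2 - g2 * h0))"
    by (simp only: mult.assoc)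
  show ?thesis
    unfolding half mult.assoc
    by (subst mid, unfold scalar_mult_quadratic [symmetric] transvectant_def)
      (simp add: quadratic_def deriv_x1_def deriv_x2_def pderiv_pCons map_poly_pCons algebra_simps)
qed

text \<open>Differentiating \<open>U\<close> twice doubles its outer coefficients and so absorbs
  their \<open>k\<close>. In the outer coefficients of the result, the factor 6 makes the terms in
  \<open>v0 * w2 + v2 * w0\<close> cancel between the two summands.\<close>

lemma psi_quadratic:
  fixes u0 u1 u2 v0 v1 v2 w0 w1 w2 :: coeff_ring
  defines "k \<equiv> rat_const (1 / 2)"
  shows "psi (quadratic (k * u0) u1 (k * u2)) (quadratic (k * v0) v1 (k * v2))
      (quadratic (k * w0) w1 (k * w2)) =
    scalar (rat_const (3 / 4)) *
    quadratic (u0 * v1 * w1 - u1 * (v0 * w1 + v1 * w0) + u2 * v0 * w0)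
      (u0 * (v1 * w2 + v2 * w1) + u2 * (v0 * w1 + v1 * w0) - u1 * (v0 * w2 + v2 * w0)
        - 2 * u1 * v1 * w1)
      (u2 * v1 * w1 - u1 * (v1 * w2 + v2 * w1) + u0 * v2 * w2)"
proof -
  \<comment> \<open>The normalising factors of (U,VW)_2 and (V,W)_2 are 1/24 and 1/4, so 1/24 serves
    as common unit; \<open>algebra\<close> then needs only \<open>24 * t = 1\<close>.\<close>
  have half: "k = rat_const (1 / 24) * 12" and quarter: "rat_const (1 / 4) = rat_const (1 / 24) * 6"
    and tq: "rat_const (3 / 4) = rat_const (1 / 24) * 18"
    and one: "rat_const (1 / 24) * 24 = 1"
    using rat_const_mult[of "1/24" 12] rat_const_mult[of "1/24" 6] rat_const_mult[of "1/24" 18]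
      rat_const_mult[of "1/24" 24]
    by (simp_all add: rat_const_numeral rat_const_1 k_def)
  define t where "t = rat_const (1 / 24)"
  have one': "24 * t = 1" using one by (simp add: t_def mult.commute)
  show ?thesis
    unfolding psi_def transvectant_def half tq
    by (simp add: quadratic_def scalar_def deriv_x1_def deriv_x2_def pderiv_pCons map_poly_pCons
          numeral_poly numeral_2_eq_2 fact_numeral quarter flip: t_def, intro conjI)
      (use one' in algebra)+
qed

text \<open>\<open>P\<close> is \<Phi> without its 3/4, multiplied on the right by the coefficients
  of a_x e_x. The products are grouped exactly as \<open>linear_form_mult\<close> and
  \<open>transvectant_quadratic_1\<close> produce them, so that the identities can rewrite the goal
  of the theorem.\<close>

lemma psi_coeff_identities:
  fixes a1 a2 b1 b2 c1 c2 d1 d2 e1 e2 f1 f2 :: "'a :: idom"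
  defines "u0 \<equiv> b1 * c1 * (d1 * f2 + d2 * f1) - (b1 * c2 + b2 * c1) * (d1 * f1)"
  defines "u1 \<equiv> b1 * c1 * (d2 * f2) - b2 * c2 * (d1 * f1)"
  defines "u2 \<equiv> (b1 * c2 + b2 * c1) * (d2 * f2) - b2 * c2 * (d1 * f2 + d2 * f1)"
  defines "v0 \<equiv> a1 * c1 * (d1 * e2 + d2 * e1) - (a1 * c2 + a2 * c1) * (d1 * e1)"
  defines "v1 \<equiv> a1 * c1 * (d2 * e2) - a2 * c2 * (d1 * e1)"
  defines "v2 \<equiv> (a1 * c2 + a2 * c1) * (d2 * e2) - a2 * c2 * (d1 * e2 + d2 * e1)"
  defines "w0 \<equiv> a1 * b1 * (e1 * f2 + e2 * f1) - (a1 * b2 + a2 * b1) * (e1 * f1)"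
  defines "w1 \<equiv> a1 * b1 * (e2 * f2) - a2 * b2 * (e1 * f1)"
  defines "w2 \<equiv> (a1 * b2 + a2 * b1) * (e2 * f2) - a2 * b2 * (e1 * f2 + e2 * f1)"
  defines "P \<equiv> (c1 * d2 - c2 * d1) * (b1 * f2 - b2 * f1) *
    ((d1 * a2 - d2 * a1) * (f1 * c2 - f2 * c1) * (e1 * b2 - e2 * b1)
     - (c1 * e2 - c2 * e1) * (b1 * d2 - b2 * d1) * (a1 * f2 - a2 * f1))"
  shows "u0 * v1 * w1 - u1 * (v0 * w1 + v1 * w0) + u2 * v0 * w0 = P * (a1 * e1)"
    and "u0 * (v1 * w2 + v2 * w1) + u2 * (v0 * w1 + v1 * w0) - u1 * (v0 * w2 + v2 * w0)
        - 2 * u1 * v1 * w1 = P * (a1 * e2 + a2 * e1)"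
    and "u2 * v1 * w1 - u1 * (v1 * w2 + v2 * w1) + u0 * v2 * w2 = P * (a2 * e2)"
  unfolding assms by algebra+

theorem proposition4p1:
  fixes a b c d e f :: "coeff_ring \<times> coeff_ring"
    and U V W :: form and S \<Phi> :: coeff_ring
  assumes "a = (indet A1, indet A2)"
    and "b = (indet B1, indet B2)"
    and "c = (indet C1, indet C2)"
    and "d = (indet D1, indet D2)"
    and "e = (indet E1, indet E2)"
    and "f = (indet F1, indet F2)"
    and "U = transvectant 2 2 1 (linear_form b * linear_form c) (linear_form d * linear_form f)"
    and "V = transvectant 2 2 1 (linear_form a * linear_form c) (linear_form d * linear_form e)"
    and "W = transvectant 2 2 1 (linear_form a * linear_form b) (linear_form e * linear_form f)"
    and "S = bracket d a * bracket f c * bracket e b - bracket c e * bracket b d * bracket a f"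
    and "\<Phi> = rat_const (3 / 4) * bracket c d * bracket b f * S"
  shows "psi U V W = scalar \<Phi> * linear_form a * linear_form e"
  unfolding assms linear_form_mult transvectant_quadratic_1
  unfolding psi_quadratic fst_conv snd_conv psi_coeff_identities
  by (simp add: linear_form_mult mult.assoc scalar_mult_quadratic bracket_def)

end
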